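(* Let $c>0$, $a>0$, $b\in(0,1)$, and $\alpha>0$ with $\alpha\ne1$, $\alpha\neq2$. For each $N\ge1$ consider $N$ homogeneous AIMD users ($\gamma_k=0$, $a_k=a$, $b_k=b$ for $k=1,\dots,N$) with capacity $cN$, and let $u_{ind}$, $u^*$ and $J(u,x,cN,N)$ be as in the context. Then for each initial state (that is, for any choice of initial states $x=x^{(N)}\in(0,\infty)^N$, $N\ge1$), the index policy is asymptotically optimal for the problem with hard capacity constraint, i.e. $$\lim_{N\to\infty}\frac1NJ(u_{ind},x,cN,N)=\lim_{N\to\infty}\frac1NJ(u^*,x,cN,N).$$
   Context: Dynamics. For $N$ users, $x_k(t)>0$ is the rate of user $k$. Between impulses $\frac{dx_k}{dt}=a$; when an impulse is applied to user $k$ at time $t$, $x_k(t+0)=bx_k(t)$. The initial state is $x(0)=x\in(0,\infty)^N$. Criterion. For a policy $u$ (a rule determining the impulse times of all users), with $N$ users, capacity $C$ and initial state $x$, $$J(u,x,C,N)=\sum_{k=1}^N\liminf_{\tau\to\infty}\frac1\tau\int_0^\tau\frac{x_k^{1-\alpha}(t)}{1-\alpha}\,dt.$$ (The capacity $C$ enters through the policy.) The hard capacity constraint is $\sum_{k=1}^Nx_k(t)\le C$ for all $t$. Index policy $u_{ind}$. Let $\lambda(x)=\frac{2(1-b^{2-\alpha})}{(1-b^2)(2-\alpha)}x^{-\alpha}$, $x>0$ (a decreasing function). Whenever the hard constraint is reached ($\sum_kx_k(t)\ge C$), the user with the minimal value of $\lambda(x_k(t))$, equivalently with the maximal rate $x_k(t)$,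 receives an impulse (ties broken by any fixed rule; at the initial time this is repeated if necessary until the sum is below $C$). Threshold policy $u^*$. Each user $k$ receives an impulse at time $t$ as soon as $x_k(t)\ge\bar x$, where $$\bar x=\frac CN\,\frac{2(1-b)}{1-b^2}.$$ This is the policy that is optimal for maximizing $\sum_k\liminf_\tau\frac1\tau E\int_0^\tau\frac{x_k^{1-\alpha}(t)}{1-\alpha}dt$ under the relaxed constraint $\sum_k\limsup_\tau\frac1\tau E\int_0^\tau x_k(t)dt\le C$. In the claim $C=cN$. *)

theory Defs
  imports "HOL-Analysis.Analysis"
begin

text \<open>
  Users are \<open>0, \<dots>, N - 1\<close>; the rates of all users at one instant form a
  state, of which only the coordinates below \<open>N\<close> matter.

  A policy is a feedback rule: given the capacity, the number of users and the current state, it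
  names the users that receive an impulse now. It is consulted again on the state after the
  impulses, at the same instant, so a rule that still asks for impulses gets them without delay.
\<close>

type_synonym state = "nat \<Rightarrow> real"

type_synonym policy = "real \<Rightarrow> nat \<Rightarrow> state \<Rightarrow> nat set"

definition drift :: "real \<Rightarrow> real \<Rightarrow> state \<Rightarrow> state" where
  "drift a s y = (\<lambda>k. y k + a * s)"

definition impulse :: "real \<Rightarrow> nat set \<Rightarrow> state \<Rightarrow> state" where
  "impulse b K y = (\<lambda>k. if k \<in> K then b * y k else y k)"

text \<open>
  Time until the rule \<open>R\<close> next asks for an impulse, starting from \<open>y\<close>;
  it is \<open>0\<close> if \<open>R\<close> asks for one in \<open>y\<close> itself. The infimum is
  meaningful when it is attained. This is so for the two policies below if \<open>N > 0\<close> and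
  \<open>a > 0\<close>: they ask for impulses exactly when some increasing continuous function of the
  state has reached a given level, and every rate grows without bound between impulses.
\<close>

definition wait :: "real \<Rightarrow> (state \<Rightarrow> nat set) \<Rightarrow> state \<Rightarrow> real" where
  "wait a R y = Inf {s. 0 \<le> s \<and> R (drift a s y) \<noteq> {}}"

text \<open>
  \<open>epoch a b R x (Suc i)\<close> is the time of the \<open>i\<close>-th application of
  impulses (counting from zero), together with the state right after it. Several consecutive
  epochs may carry the same time.
\<close>

primrec epoch :: "real \<Rightarrow> real \<Rightarrow> (state \<Rightarrow> nat set) \<Rightarrow> state \<Rightarrow> nat \<Rightarrow> real \<times> state" where
  "epoch a b R x 0 = (0, x)"
| "epoch a b R x (Suc i) =
     (let (t, y) = epoch a b R x i;
          s = wait a R y;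
          z = drift a s y
      in (t + s, impulse b (R z) z))"

text \<open>
  Left-continuous version: at an impulse time the value is the one before the impulse, and the
  right limit is the state after all impulses given at that time. At time \<open>0\<close> the value
  is the initial state.
\<close>

definition trajectory :: "real \<Rightarrow> real \<Rightarrow> (state \<Rightarrow> nat set) \<Rightarrow> state \<Rightarrow> real \<Rightarrow> state" where
  "trajectory a b R x t =
     (let i = (LEAST i. t \<le> fst (epoch a b R x (Suc i)))
      in drift a (t - fst (epoch a b R x i)) (snd (epoch a b R x i)))"

lemma trajectory_between_epochs:
  assumes "mono (\<lambda>i. fst (epoch a b R x i))"
    and "fst (epoch a b R x i) < t" "t \<le> fst (epoch a b R x (Suc i))"
  shows "trajectory a b R x t k = snd (epoch a b R x i) k + a * (t - fst (epoch a b R x i))"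
proof -
  have "(LEAST j. t \<le> fst (epoch a b R x (Suc j))) = i"
  proof (rule Least_equality)
    fix j assume j: "t \<le> fst (epoch a b R x (Suc j))"
    show "i \<le> j"
    proof (rule ccontr)
      assume "\<not> i \<le> j"
      then have "fst (epoch a b R x (Suc j)) \<le> fst (epoch a b R x i)"
        using monoD[OF assms(1), of "Suc j" i] by simp
      with j assms(2) show False by linarith
    qed
  qed (rule assms(3))
  then show ?thesis
    by (simp only: trajectory_def Let_def drift_def)
qed

definition J :: "real \<Rightarrow> real \<Rightarrow> real \<Rightarrow> policy \<Rightarrow> state \<Rightarrow> real \<Rightarrow> nat \<Rightarrow> ereal" where
  "J a b \<alpha> u x C N =
     (\<Sum>k<N. Liminf at_top (\<lambda>\<tau>::real.
        ereal (1 / \<tau> * integral {0..\<tau>}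
          (\<lambda>t. trajectory a b (u C N) x t k powr (1 - \<alpha>) / (1 - \<alpha>)))))"

definition index_fun :: "real \<Rightarrow> real \<Rightarrow> real \<Rightarrow> real" where
  "index_fun b \<alpha> x = 2 * (1 - b powr (2 - \<alpha>)) / ((1 - b\<^sup>2) * (2 - \<alpha>)) * x powr (- \<alpha>)"

text \<open>
  A tie-breaking rule chooses one user out of a set of tied users; it may depend on the number of
  users and on the current state.
\<close>

type_synonym tie_rule = "nat \<Rightarrow> state \<Rightarrow> nat set \<Rightarrow> nat"

definition is_tie_rule :: "tie_rule \<Rightarrow> bool" where
  "is_tie_rule tie \<longleftrightarrow> (\<forall>N y S. finite S \<and> S \<noteq> {} \<longrightarrow> tie N y S \<in> S)"

definition index_policy :: "real \<Rightarrow> real \<Rightarrow> tie_rule \<Rightarrow> policy" where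
  "index_policy b \<alpha> tie C N y =
     (if (\<Sum>k<N. y k) \<ge> C
      then {tie N y {k. is_arg_min (\<lambda>j. index_fun b \<alpha> (y j)) (\<lambda>j. j < N) k}}
      else {})"

definition threshold :: "real \<Rightarrow> real \<Rightarrow> nat \<Rightarrow> real" where
  "threshold b C N = C / real N * (2 * (1 - b) / (1 - b\<^sup>2))"

definition threshold_policy :: "real \<Rightarrow> policy" where
  "threshold_policy b C N y = {k. k < N \<and> y k \<ge> threshold b C N}"

end

theory Submission
  imports Defs "HOL-Library.Multiset"
begin

text \<open>
  Between impulses a rate grows at slope \<open>a\<close>, so with \<open>G' = f\<close> the integral of
  \<open>f (x\<^sub>k)\<close> and the elapsed time are both telescoping sums over the impulses of user
  \<open>k\<close>, with terms \<open>(G m - G (b m)) / a\<close> and \<open>(m - b m) / a\<close> for an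
  impulse given at level \<open>m\<close>. If the impulse levels of a user converge to \<open>m\<close>, the
  time average is therefore \<open>(G m - G (b m)) / ((1 - b) m)\<close>.

  Under the threshold policy the levels eventually equal the threshold \<open>2 c / (1 + b)\<close>.
  Under the index policy the rates are eventually within a factor \<open>b\<close> of each other, after
  which the users are served cyclically. The impulse levels \<open>M\<close> then satisfy
  \<open>M (n + N) = b M n + (1 - b) / N (M n + \<dots> + M (n + N - 1))\<close>, which forces
  convergence, and the capacity constraint identifies the limit as
  \<open>2 c N / (N (1 + b) + 1 - b)\<close>, which tends to the threshold.
\<close>

section \<open>Time averages of an impulsively controlled rate\<close>

locale impulse_flow =
  fixes a b :: real and R :: "state \<Rightarrow> nat set" and x :: state
  assumes a_pos: "0 < a" and b_pos: "0 < b" and b_less_1: "b < 1"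
begin

definition T :: "nat \<Rightarrow> real" where "T i = fst (epoch a b R x i)"

definition Y :: "nat \<Rightarrow> state" where "Y i = snd (epoch a b R x i)"

text \<open>The left limit at the epoch time \<open>T (Suc i)\<close>: the state on which the
  impulses act that lead to \<open>Y (Suc i)\<close>.\<close>

definition Z :: "nat \<Rightarrow> state" where "Z i = drift a (wait a R (Y i)) (Y i)"

lemma T_0 [simp]: "T 0 = 0" and Y_0 [simp]: "Y 0 = x"
  by (simp_all add: T_def Y_def)

lemma T_Suc: "T (Suc i) = T i + wait a R (Y i)"
  by (simp add: T_def Y_def split_beta Let_def)

lemma Z_eq: "Z i k = Y i k + a * (T (Suc i) - T i)"
  by (simp add: Z_def T_Suc drift_def)

lemma Y_Suc: "Y (Suc i) k = (if k \<in> R (Z i) then b * Z i k else Z i k)"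
  by (simp add: Y_def Z_def split_beta Let_def impulse_def)

text \<open>Drift is the only gain and impulses are the only loss. This balance converts elapsed
  time into a sum of drops over impulses.\<close>

lemma levels_telescope:
  "Y n k + (\<Sum>i<n. Z i k - Y (Suc i) k) = x k + a * T n"
  by (induction n) (simp_all add: Z_eq algebra_simps)

end

text \<open>The infimum in \<open>wait\<close> is an unspecified real if the rule never fires, so
  its sign is an assumption here. Each policy discharges it by an explicit formula.\<close>

locale forward_flow = impulse_flow +
  assumes wait_nonneg: "0 \<le> wait a R (Y i)"
begin

lemma T_mono: "mono T"
  by (intro incseq_SucI) (simp add: T_Suc wait_nonneg)

lemma Y_le_Z: "Y i k \<le> Z i k"
  using a_pos wait_nonneg[of i] by (simp add: Z_eq T_Suc)

text \<open>Excludes infinitely many impulses in bounded time. Every epoch removes at least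
  \<open>(1 - b) * m\<close> from the total rate of \<open>A\<close>, which stays positive and is
  refilled only by drift, so time grows at least linearly in the number of epochs.\<close>

lemma T_at_top:
  assumes "finite A" and "0 < m" and pos: "\<And>i k. k \<in> A \<Longrightarrow> 0 < Y i k"
    and hit: "\<And>i. \<exists>k\<in>A. k \<in> R (Z i) \<and> m \<le> Z i k"
  shows "filterlim T at_top sequentially"
proof -
  have ne: "A \<noteq> {}" using hit by blast
  have drop: "0 \<le> Z i k - Y (Suc i) k" if "k \<in> A" for i k
    using pos[OF that, of i] Y_le_Z[of i k] b_less_1 by (simp add: Y_Suc)
  have "(1 - b) * m \<le> (\<Sum>k\<in>A. Z i k - Y (Suc i) k)" for i
  proof -
    obtain k where k: "k \<in> A" "k \<in> R (Z i)" "m \<le> Z i k" using hit by blast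
    have "(1 - b) * m \<le> (1 - b) * Z i k" using k b_less_1 by simp
    also have "\<dots> = Z i k - Y (Suc i) k" using k by (simp add: Y_Suc algebra_simps)
    also have "\<dots> \<le> (\<Sum>k\<in>A. Z i k - Y (Suc i) k)"
      using k drop \<open>finite A\<close> by (intro member_le_sum) auto
    finally show ?thesis .
  qed
  then have "real n * ((1 - b) * m) \<le> (\<Sum>i<n. \<Sum>k\<in>A. Z i k - Y (Suc i) k)" for n
    using sum_mono[of "{..<n}" "\<lambda>_. (1 - b) * m"] by simp
  moreover have "(\<Sum>i<n. \<Sum>k\<in>A. Z i k - Y (Suc i) k) \<le> (\<Sum>k\<in>A. x k) + real (card A) * a * T n" for n
  proof -
    have "(\<Sum>i<n. \<Sum>k\<in>A. Z i k - Y (Suc i) k) = (\<Sum>k\<in>A. x k + a * T n - Y n k)"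
      by (subst sum.swap) (simp add: levels_telescope[symmetric])
    also have "\<dots> \<le> (\<Sum>k\<in>A. x k + a * T n)"
      using pos by (intro sum_mono) (simp add: less_imp_le)
    finally show ?thesis by (simp add: sum.distrib)
  qed
  ultimately have *: "real n * ((1 - b) * m) \<le> (\<Sum>k\<in>A. x k) + real (card A) * a * T n" for n
    by (meson order_trans)
  have cA: "0 < real (card A) * a" using ne \<open>finite A\<close> a_pos by (simp add: card_gt_0_iff)
  show ?thesis
  proof (rule filterlim_at_top_mono)
    show "\<forall>\<^sub>F n in sequentially.
        - (\<Sum>k\<in>A. x k) / (real (card A) * a) + (1 - b) * m / (real (card A) * a) * real n \<le> T n"
    proof (intro always_eventually allI)
      fix n
      have "((1 - b) * m * real n - (\<Sum>k\<in>A. x k)) / (real (card A) * a) \<le> T n"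
        using *[of n] cA by (subst pos_divide_le_eq) (simp_all add: mult_ac)
      then show "- (\<Sum>k\<in>A. x k) / (real (card A) * a) + (1 - b) * m / (real (card A) * a) * real n \<le> T n"
        by (simp add: diff_divide_distrib)
    qed
    have "0 < (1 - b) * m / (real (card A) * a)"
      using cA b_less_1 \<open>0 < m\<close> by simp
    then show "LIM n sequentially.
        - (\<Sum>k\<in>A. x k) / (real (card A) * a) + (1 - b) * m / (real (card A) * a) * real n :> at_top"
      by (intro filterlim_tendsto_add_at_top[OF tendsto_const]
            filterlim_tendsto_pos_mult_at_top[OF tendsto_const] filterlim_real_sequentially)
  qed
qed

text \<open>Between epochs, \<open>G / a\<close> evaluated along the rate is a primitive in time.
  Adding the pieces leaves the two end values and the jumps of \<open>G\<close> at impulses. The end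
  time is generalized in the induction so that the hypothesis can be used at
  \<open>T (Suc n)\<close>.\<close>

lemma trajectory_has_integral:
  assumes G: "\<And>v. 0 < v \<Longrightarrow> (G has_real_derivative f v) (at v)"
    and pos: "\<And>i. 0 < Y i k" and "T n \<le> \<tau>" "\<tau> \<le> T (Suc n)"
  shows "((\<lambda>t. f (trajectory a b R x t k)) has_integral
    (G (Y n k + a * (\<tau> - T n)) - G (x k) + (\<Sum>i<n. G (Z i k) - G (Y (Suc i) k))) / a) {0..\<tau>}"
  using assms(3,4)
proof (induction n arbitrary: \<tau>)
  have piece: "((\<lambda>t. f (trajectory a b R x t k)) has_integral
      (G (Y n k + a * (\<tau> - T n)) - G (Y n k)) / a) {T n..\<tau>}"
    if "T n \<le> \<tau>" "\<tau> \<le> T (Suc n)" for n \<tau>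
  proof -
    have "((\<lambda>t. G (Y n k + a * (t - T n)) / a) has_vector_derivative f (Y n k + a * (t - T n)))
        (at t within {T n..\<tau>})" if "t \<in> {T n..\<tau>}" for t
    proof -
      have "0 < Y n k + a * (t - T n)"
        using that a_pos pos[of n] by (simp add: add_pos_nonneg)
      then have "((\<lambda>t. G (Y n k + a * (t - T n))) has_real_derivative f (Y n k + a * (t - T n)) * a) (at t)"
        by (intro DERIV_chain2[where f = G and g = "\<lambda>t. Y n k + a * (t - T n)"] G)
           (auto intro!: derivative_eq_intros)
      from DERIV_cdivide[OF this, of a] show ?thesis
        using a_pos by (simp add: has_real_derivative_iff_has_vector_derivative
            has_vector_derivative_at_within)
    qed
    then have "((\<lambda>t. f (Y n k + a * (t - T n))) has_integral
        (G (Y n k + a * (\<tau> - T n)) / a - G (Y n k + a * (T n - T n)) / a)) {T n..\<tau>}"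
      using that by (intro fundamental_theorem_of_calculus) auto
    then have "((\<lambda>t. f (Y n k + a * (t - T n))) has_integral
        (G (Y n k + a * (\<tau> - T n)) - G (Y n k)) / a) {T n..\<tau>}"
      by (simp add: diff_divide_distrib)
    \<comment> \<open>At \<open>T n\<close> itself the left-continuous trajectory may still have its
      value before the impulse; one point does not affect the integral.\<close>
    then show ?thesis
    proof (rule has_integral_spike_finite[of "{T n}", rotated 2])
      fix t assume "t \<in> {T n..\<tau>} - {T n}"
      then have "T n < t" "t \<le> T (Suc n)" using that by auto
      then show "f (trajectory a b R x t k) = f (Y n k + a * (t - T n))"
        using trajectory_between_epochs[of a b R x n t k] T_mono
        by (simp add: T_def[abs_def] Y_def)
    qed simp
  qed
  {
    case 0
    then show ?case using piece[of 0 \<tau>] by simp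
  next
    case (Suc n)
    have "T n \<le> T (Suc n)" using T_mono by (simp add: monoD)
    note I = Suc.IH[OF this order_refl]
    have "0 \<le> T (Suc n)" using monoD[OF T_mono, of 0 "Suc n"] by simp
    from has_integral_combine[OF this Suc.prems(1) I piece[OF Suc.prems]] show ?case
      by (simp add: Z_eq add_divide_distrib diff_divide_distrib algebra_simps)
  }
qed

lemma epoch_containing:
  assumes "filterlim T at_top sequentially" and "0 \<le> \<tau>"
  obtains n where "T n \<le> \<tau>" "\<tau> \<le> T (Suc n)"
proof -
  have "\<exists>n. \<tau> \<le> T n"
    using assms(1) by (auto simp: filterlim_at_top eventually_sequentially)
  define m where m: "m = (LEAST n. \<tau> \<le> T n)"
  have le: "\<tau> \<le> T m"
    unfolding m using \<open>\<exists>n. \<tau> \<le> T n\<close> by (rule LeastI_ex)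
  show thesis
  proof (cases m)
    case 0
    then show thesis
      using that[of 0] le assms(2) monoD[OF T_mono, of 0 "Suc 0"] by simp
  next
    case (Suc n)
    then have "T n \<le> \<tau>" using not_less_Least[of n "\<lambda>n. \<tau> \<le> T n"] m by simp
    then show thesis using le Suc by (intro that[of n]) auto
  qed
qed

text \<open>With \<open>F\<close> the claimed limit, integral minus \<open>F * \<tau>\<close> is a
  sum of one error per impulse plus boundary terms. Once the levels are near \<open>m\<close>, each
  error is a small multiple of its drop, and the drops add up to \<open>a * \<tau>\<close> up to a
  bounded amount. The bounds \<open>lo\<close> and \<open>hi\<close> control the boundary
  terms.\<close>

lemma time_average:
  assumes G: "\<And>v. 0 < v \<Longrightarrow> (G has_real_derivative f v) (at v)"
    and "filterlim T at_top sequentially"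
    and "0 < lo" and lo: "\<And>i. lo \<le> Y i k" and hi: "\<And>i. Z i k \<le> hi"
    and "0 < m" and level: "\<And>e. 0 < e \<Longrightarrow> \<forall>\<^sub>F i in sequentially. k \<in> R (Z i) \<longrightarrow> \<bar>Z i k - m\<bar> < e"
  shows "((\<lambda>\<tau>. 1 / \<tau> * integral {0..\<tau>} (\<lambda>t. f (trajectory a b R x t k)))
    \<longlongrightarrow> (G m - G (b * m)) / ((1 - b) * m)) at_top"
proof -
  define F where "F = (G m - G (b * m)) / ((1 - b) * m)"
  \<comment> \<open>The error of one epoch, scaled by \<open>a\<close>; it vanishes if user
    \<open>k\<close> is not served, and for a service at level exactly \<open>m\<close>.\<close>
  define D where "D i = G (Z i k) - G (Y (Suc i) k) - F * (Z i k - Y (Suc i) k)" for i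
  define d where "d i = Z i k - Y (Suc i) k" for i
  have Ypos: "0 < Y i k" for i using lo[of i] \<open>0 < lo\<close> by linarith
  have Zpos: "0 < Z i k" for i using Y_le_Z[of i k] Ypos[of i] by linarith
  have d_nonneg: "0 \<le> d i" for i
    using Zpos[of i] b_less_1 by (simp add: d_def Y_Suc)
  have F_cont: "((\<lambda>v. (G v - G (b * v)) / ((1 - b) * v)) \<longlongrightarrow> F) (nhds m)"
  proof -
    have "isCont G m" and "isCont G (b * m)"
      using G[of m] G[of "b * m"] \<open>0 < m\<close> b_pos by (auto intro: DERIV_isCont)
    then have "isCont (\<lambda>v. (G v - G (b * v)) / ((1 - b) * v)) m"
      using \<open>0 < m\<close> b_less_1 by (intro continuous_intros isCont_o2[of m "\<lambda>v. b * v" G]) auto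
    then show ?thesis
      unfolding F_def isCont_def
      by (rule tendsto_at_iff_tendsto_nhds[where g = "\<lambda>v. (G v - G (b * v)) / ((1 - b) * v)", THEN iffD1])
  qed
  have D_small: "\<forall>\<^sub>F i in sequentially. \<bar>D i\<bar> \<le> e * d i" if "0 < e" for e
  proof -
    have "\<forall>\<^sub>F v in nhds m. \<bar>(G v - G (b * v)) / ((1 - b) * v) - F\<bar> < e"
      using tendstoD[OF F_cont that] by (simp add: dist_real_def)
    then obtain r where r: "0 < r"
      "\<And>v. \<bar>v - m\<bar> < r \<Longrightarrow> \<bar>(G v - G (b * v)) / ((1 - b) * v) - F\<bar> < e"
      by (auto simp: eventually_nhds_metric dist_real_def)
    from level[OF r(1)] show ?thesis
    proof eventually_elim
      case (elim i)
      show ?case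
      proof (cases "k \<in> R (Z i)")
        case True
        let ?v = "Z i k"
        have v: "0 < (1 - b) * ?v" using Zpos[of i] b_less_1 by simp
        have di: "d i = (1 - b) * ?v" using True by (simp add: d_def Y_Suc algebra_simps)
        have "D i = ((G ?v - G (b * ?v)) / ((1 - b) * ?v) - F) * d i"
          using True v b_less_1 Zpos[of i] by (simp add: D_def Y_Suc di field_simps)
        then have "\<bar>D i\<bar> = \<bar>(G ?v - G (b * ?v)) / ((1 - b) * ?v) - F\<bar> * d i"
          using d_nonneg[of i] by (simp add: abs_mult)
        also have "\<dots> \<le> e * d i"
          using r(2)[of ?v] elim True d_nonneg[of i] by (intro mult_right_mono) auto
        finally show ?thesis .
      qed (simp add: D_def d_def Y_Suc)
    qed
  qed
  \<comment> \<open>Compactness of the range of rates, which stays away from \<open>0\<close>,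
    bounds the boundary terms uniformly in time.\<close>
  have "continuous_on {lo..hi} (\<lambda>v. \<bar>G v\<bar> + \<bar>F * v\<bar>)"
  proof -
    have "continuous_on {lo..hi} G"
      using \<open>0 < lo\<close> by (intro continuous_at_imp_continuous_on ballI DERIV_isCont[OF G]) simp
    then show ?thesis by (intro continuous_intros)
  qed
  then have "bounded ((\<lambda>v. \<bar>G v\<bar> + \<bar>F * v\<bar>) ` {lo..hi})"
    by (intro compact_imp_bounded compact_continuous_image compact_Icc)
  then obtain B where B: "\<And>v. v \<in> {lo..hi} \<Longrightarrow> \<bar>G v\<bar> + \<bar>F * v\<bar> \<le> B"
    unfolding bounded_real by fastforce
  \<comment> \<open>The epochs before \<open>q\<close> contribute a constant, which division by
    \<open>\<tau>\<close> will remove; only the later ones need the small factor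
    \<open>e\<close>.\<close>
  have key: "\<bar>integral {0..\<tau>} (\<lambda>t. f (trajectory a b R x t k)) - F * \<tau>\<bar>
      \<le> (2 * B + (\<Sum>i<q. \<bar>D i\<bar>)) / a + e * (hi / a + \<tau>)"
    if "0 \<le> \<tau>" "0 < e" and q: "\<And>i. q \<le> i \<Longrightarrow> \<bar>D i\<bar> \<le> e * d i" for \<tau> e q
  proof -
    obtain n where n: "T n \<le> \<tau>" "\<tau> \<le> T (Suc n)"
      using epoch_containing[OF assms(2) \<open>0 \<le> \<tau>\<close>] by blast
    define w where "w = Y n k + a * (\<tau> - T n)"
    have aw: "a * \<tau> = w - x k + (\<Sum>i<n. d i)"
      using levels_telescope[of n k] by (simp add: w_def d_def algebra_simps)
    have "w \<le> Z n k" unfolding w_def Z_eq using n a_pos by simp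
    moreover have "Y n k \<le> w" unfolding w_def using n a_pos by simp
    ultimately have w: "w \<in> {lo..hi}" using lo[of n] hi[of n] by simp
    have x: "x k \<in> {lo..hi}" using lo[of 0] hi[of 0] Y_le_Z[of 0 k] by simp
    have "integral {0..\<tau>} (\<lambda>t. f (trajectory a b R x t k))
        = (G w - G (x k) + (\<Sum>i<n. G (Z i k) - G (Y (Suc i) k))) / a"
      using trajectory_has_integral[OF G Ypos n] by (simp add: w_def integral_unique)
    moreover have "F * \<tau> = (F * w - F * x k + (\<Sum>i<n. F * d i)) / a"
    proof -
      have "F * \<tau> = F * (a * \<tau>) / a" using a_pos by simp
      then show ?thesis unfolding aw by (simp add: algebra_simps sum_distrib_left)
    qed
    ultimately have "integral {0..\<tau>} (\<lambda>t. f (trajectory a b R x t k)) - F * \<tau>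
        = ((G w - F * w) - (G (x k) - F * x k) + (\<Sum>i<n. D i)) / a"
      by (simp add: D_def d_def sum_subtractf diff_divide_distrib add_divide_distrib)
    also have "\<bar>\<dots>\<bar> \<le> (2 * B + (\<Sum>i<n. \<bar>D i\<bar>)) / a"
    proof -
      have "\<bar>(G w - F * w) - (G (x k) - F * x k) + (\<Sum>i<n. D i)\<bar> \<le> 2 * B + (\<Sum>i<n. \<bar>D i\<bar>)"
        using B[OF w] B[OF x] sum_abs[of D "{..<n}"] by linarith
      then show ?thesis using a_pos by (simp add: divide_right_mono)
    qed
    also have "(\<Sum>i<n. \<bar>D i\<bar>) \<le> (\<Sum>i<q. \<bar>D i\<bar>) + e * (hi + a * \<tau>)"
    proof -
      have "(\<Sum>i<n. \<bar>D i\<bar>) \<le> (\<Sum>i\<in>{..<q} \<union> {q..<n}. \<bar>D i\<bar>)"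
        by (intro sum_mono2) auto
      also have "\<dots> = (\<Sum>i<q. \<bar>D i\<bar>) + (\<Sum>i=q..<n. \<bar>D i\<bar>)"
        by (rule sum.union_disjoint) auto
      also have "(\<Sum>i=q..<n. \<bar>D i\<bar>) \<le> (\<Sum>i=q..<n. e * d i)"
        using q by (intro sum_mono) auto
      also have "\<dots> \<le> (\<Sum>i<n. e * d i)"
        using d_nonneg that(2) by (intro sum_mono2) auto
      also have "\<dots> = e * (a * \<tau> + x k - w)"
        using aw by (simp add: sum_distrib_left[symmetric])
      also have "\<dots> \<le> e * (hi + a * \<tau>)"
        using w x \<open>0 < lo\<close> that(2) by (intro mult_left_mono) auto
      finally show ?thesis by simp
    qed
    finally show ?thesis
      using a_pos by (simp add: add_divide_distrib divide_right_mono algebra_simps)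
  qed
  have "((\<lambda>\<tau>. 1 / \<tau> * integral {0..\<tau>} (\<lambda>t. f (trajectory a b R x t k))) \<longlongrightarrow> F) at_top"
  proof (rule tendstoI)
    fix e :: real assume "0 < e"
    then obtain q where q: "\<And>i. q \<le> i \<Longrightarrow> \<bar>D i\<bar> \<le> e / 2 * d i"
      using D_small[of "e / 2"] by (auto simp: eventually_sequentially)
    define B' where "B' = (2 * B + (\<Sum>i<q. \<bar>D i\<bar>)) / a + e / 2 * (hi / a)"
    show "\<forall>\<^sub>F \<tau> in at_top. dist (1 / \<tau> * integral {0..\<tau>} (\<lambda>t. f (trajectory a b R x t k))) F < e"
      using eventually_gt_at_top[of "max 0 (2 * B' / e)"]
    proof eventually_elim
      case (elim \<tau>)
      then have \<tau>: "0 < \<tau>" "B' < e / 2 * \<tau>" using \<open>0 < e\<close> by (auto simp: field_simps)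
      let ?I = "integral {0..\<tau>} (\<lambda>t. f (trajectory a b R x t k))"
      have "\<bar>?I - F * \<tau>\<bar> \<le> B' + e / 2 * \<tau>"
        using key[of \<tau> "e / 2" q, OF _ _ q] \<tau> \<open>0 < e\<close> unfolding B'_def distrib_left by linarith
      also have "\<dots> < e * \<tau>" using \<tau> by simp
      finally have "\<bar>?I - F * \<tau>\<bar> / \<tau> < e" using \<tau> by (simp add: field_simps)
      moreover have "1 / \<tau> * ?I - F = (?I - F * \<tau>) / \<tau>" using \<tau> by (simp add: field_simps)
      ultimately show ?case using \<tau> by (simp add: dist_real_def)
    qed
  qed
  then show ?thesis by (simp add: F_def)
qed

end

section \<open>The utility and its mean over one impulse cycle\<close>

definition util_prim :: "real \<Rightarrow> real \<Rightarrow> real" where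
  "util_prim \<alpha> v = v powr (2 - \<alpha>) / ((1 - \<alpha>) * (2 - \<alpha>))"

text \<open>Time average of the utility while a rate climbs from \<open>b * m\<close> to
  \<open>m\<close>. The climb lasts \<open>(1 - b) * m / a\<close>, and the slope \<open>a\<close>
  cancels.\<close>

definition cycle_mean :: "real \<Rightarrow> real \<Rightarrow> real \<Rightarrow> real" where
  "cycle_mean b \<alpha> m = (util_prim \<alpha> m - util_prim \<alpha> (b * m)) / ((1 - b) * m)"

lemma util_prim_deriv:
  assumes "\<alpha> \<noteq> 2" and "0 < v"
  shows "(util_prim \<alpha> has_real_derivative v powr (1 - \<alpha>) / (1 - \<alpha>)) (at v)"
proof -
  have "((\<lambda>v. v powr (2 - \<alpha>) / ((1 - \<alpha>) * (2 - \<alpha>))) has_real_derivative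
      (2 - \<alpha>) * v powr (2 - \<alpha> - 1) / ((1 - \<alpha>) * (2 - \<alpha>))) (at v)"
    using assms by (intro DERIV_cdivide has_real_derivative_powr)
  then show ?thesis
    using assms(1) by (simp add: util_prim_def[abs_def] diff_diff_eq2 add.commute)
qed

lemma isCont_cycle_mean:
  assumes "\<alpha> \<noteq> 2" "0 < b" "b < 1" "0 < m"
  shows "isCont (cycle_mean b \<alpha>) m"
proof -
  have "isCont (util_prim \<alpha>) m" and "isCont (util_prim \<alpha>) (b * m)"
    using assms by (auto intro!: DERIV_isCont util_prim_deriv)
  then show ?thesis
    unfolding cycle_mean_def[abs_def] using assms
    by (intro continuous_intros isCont_o2[of m "\<lambda>v. b * v" "util_prim \<alpha>"]) auto
qed

context forward_flow
begin

text \<open>Otherwise every epoch would take place at time \<open>0\<close>. A positive wait occurs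
  only in a state strictly below the level that triggers the policy, so it marks a moment when any
  initial excess is gone.\<close>

lemma positive_wait:
  assumes "filterlim T at_top sequentially"
  obtains i where "0 < wait a R (Y i)"
proof (rule ccontr)
  assume "\<not> thesis"
  then have "\<not> 0 < wait a R (Y i)" for i using that by blast
  then have "wait a R (Y i) = 0" for i using wait_nonneg[of i] by (simp add: order.antisym not_less)
  then have "T i = 0" for i by (induction i) (simp_all add: T_Suc)
  moreover have "\<forall>\<^sub>F i in sequentially. 1 \<le> T i"
    using assms by (simp add: filterlim_at_top)
  ultimately show False by simp
qed

text \<open>The time averages of all users converge to the same value, so every lower limit is a
  limit and the sum is \<open>N\<close> times that value.\<close>

lemma J_eq_cycle_mean:
  assumes "u C N = R" and "\<alpha> \<noteq> 2"
    and "filterlim T at_top sequentially"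
    and "\<And>k. k < N \<Longrightarrow> 0 < lo k" and "\<And>i k. k < N \<Longrightarrow> lo k \<le> Y i k"
    and "\<And>i k. k < N \<Longrightarrow> Z i k \<le> hi k"
    and "0 < m" and "\<And>k e. k < N \<Longrightarrow> 0 < e \<Longrightarrow>
      \<forall>\<^sub>F i in sequentially. k \<in> R (Z i) \<longrightarrow> \<bar>Z i k - m\<bar> < e"
  shows "J a b \<alpha> u x C N = ereal (real N * cycle_mean b \<alpha> m)"
proof -
  have "Liminf at_top (\<lambda>\<tau>. ereal (1 / \<tau> * integral {0..\<tau>}
      (\<lambda>t. trajectory a b R x t k powr (1 - \<alpha>) / (1 - \<alpha>)))) = ereal (cycle_mean b \<alpha> m)"
    if "k < N" for k
    using time_average[of "util_prim \<alpha>" "\<lambda>v. v powr (1 - \<alpha>) / (1 - \<alpha>)" "lo k" k "hi k" m,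
        OF util_prim_deriv[OF assms(2)] assms(3) assms(4-6)[OF that] assms(7) assms(8)[OF that]] that
    by (intro lim_imp_Liminf) (auto simp: cycle_mean_def)
  then show ?thesis
    by (simp add: J_def assms(1) sum.cong)
qed

end

text \<open>The firing times form a closed half-line, hence the infimum is attained.\<close>

lemma wait_eqI:
  assumes "0 \<le> s" and "\<And>r. 0 \<le> r \<Longrightarrow> R (drift a r y) \<noteq> {} \<longleftrightarrow> s \<le> r"
  shows "wait a R y = s"
proof -
  have "{r. 0 \<le> r \<and> R (drift a r y) \<noteq> {}} = {s..}"
    using assms by (auto intro: order_trans)
  then show ?thesis by (simp add: wait_def)
qed

section \<open>The threshold policy\<close>

locale threshold_flow =
  fixes a b :: real and R :: "state \<Rightarrow> nat set" and x :: state and h :: real and N :: nat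
  assumes a_pos: "0 < a" and b_pos: "0 < b" and b_less_1: "b < 1"
    and h_pos: "0 < h" and N_pos: "0 < N" and x_pos: "\<And>k. k < N \<Longrightarrow> 0 < x k"
    and R_eq: "R = (\<lambda>y. {k. k < N \<and> h \<le> y k})"
begin

sublocale impulse_flow a b R x
  by unfold_locales (rule a_pos b_pos b_less_1)+

lemma R_iff: "k \<in> R y \<longleftrightarrow> k < N \<and> h \<le> y k"
  by (simp add: R_eq)

lemma wait_eq: "wait a R y = max 0 (Min ((\<lambda>k. (h - y k) / a) ` {..<N}))"
proof (rule wait_eqI)
  fix r :: real assume "0 \<le> r"
  have "R (drift a r y) \<noteq> {} \<longleftrightarrow> (\<exists>k<N. (h - y k) / a \<le> r)"
    using a_pos by (auto simp: ex_in_conv[symmetric] R_iff drift_def field_simps)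
  also have "\<dots> \<longleftrightarrow> Min ((\<lambda>k. (h - y k) / a) ` {..<N}) \<le> r"
    using N_pos by (subst Min_le_iff) auto
  finally show "R (drift a r y) \<noteq> {} \<longleftrightarrow> max 0 (Min ((\<lambda>k. (h - y k) / a) ` {..<N})) \<le> r"
    using \<open>0 \<le> r\<close> by simp
qed simp

sublocale forward_flow a b R x
  by unfold_locales (simp add: wait_eq)

lemma hit: "\<exists>k<N. h \<le> Z i k"
proof -
  have "Min ((\<lambda>k. (h - Y i k) / a) ` {..<N}) \<in> (\<lambda>k. (h - Y i k) / a) ` {..<N}"
    using N_pos by (intro Min_in) auto
  then obtain k where k: "k < N" "Min ((\<lambda>k. (h - Y i k) / a) ` {..<N}) = (h - Y i k) / a"
    by auto
  then have "(h - Y i k) / a \<le> wait a R (Y i)" by (simp add: wait_eq)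
  then have "h \<le> Z i k" using a_pos by (simp add: Z_eq T_Suc field_simps)
  with k show ?thesis by blast
qed

lemma Z_le_if_wait:
  assumes "0 < wait a R (Y i)" and "k < N"
  shows "Z i k \<le> h"
proof -
  have "wait a R (Y i) \<le> (h - Y i k) / a"
    using assms by (auto simp: wait_eq less_max_iff_disj intro!: Min_le)
  then show ?thesis using a_pos by (simp add: Z_eq T_Suc field_simps)
qed

lemma Z_le_max: "k < N \<Longrightarrow> Z i k \<le> max h (Y i k)"
  using Z_le_if_wait[of i k] wait_nonneg[of i] by (cases "wait a R (Y i) = 0") (auto simp: Z_eq T_Suc)

lemma Y_lower: "k < N \<Longrightarrow> min (b * h) (x k) \<le> Y i k"
proof (induction i)
  case (Suc i)
  then have "min (b * h) (x k) \<le> Z i k" using Y_le_Z[of i k] by simp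
  moreover have "b * h \<le> b * Z i k" if "k \<in> R (Z i)"
    using that b_pos by (simp add: R_iff)
  ultimately show ?case by (auto simp: Y_Suc)
qed simp

lemma lower_pos: "k < N \<Longrightarrow> 0 < min (b * h) (x k)"
  using b_pos h_pos x_pos by simp

lemma Y_pos: "k < N \<Longrightarrow> 0 < Y i k"
  using Y_lower lower_pos less_le_trans by blast

lemma Y_Suc_le: "k < N \<Longrightarrow> Y (Suc i) k \<le> Z i k"
  using Y_pos[of k i] Y_le_Z[of i k] b_less_1 by (simp add: Y_Suc)

lemma Z_upper: "k < N \<Longrightarrow> Z i k \<le> max h (x k)"
proof (induction i)
  case 0
  then show ?case using Z_le_max[of k 0] by simp
next
  case (Suc i)
  then show ?case using Z_le_max[of k "Suc i"] Y_Suc_le[of k i] by simp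
qed

lemma T_diverges: "filterlim T at_top sequentially"
proof (rule T_at_top[of "{..<N}" h])
  show "\<exists>k\<in>{..<N}. k \<in> R (Z i) \<and> h \<le> Z i k" for i
    using hit[of i] by (auto simp: R_iff)
qed (use Y_pos h_pos in auto)

text \<open>A positive wait ends when the first user reaches \<open>h\<close>, so all rates are then
  at most \<open>h\<close>. Afterwards impulses only lower rates and drift never carries one past
  \<open>h\<close>.\<close>

lemma eventually_Z_le: "\<forall>\<^sub>F i in sequentially. \<forall>k<N. Z i k \<le> h"
proof -
  obtain i where i: "0 < wait a R (Y i)" using positive_wait[OF T_diverges] .
  have "\<forall>k<N. Z j k \<le> h" if "i \<le> j" for j
    using that
  proof (induction rule: dec_induct)
    case base
    then show ?case using Z_le_if_wait[OF i] by blast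
  next
    case (step j)
    show ?case
    proof (intro allI impI)
      fix k assume "k < N"
      then show "Z (Suc j) k \<le> h"
        using Z_le_max[of k "Suc j"] Y_Suc_le[of k j] step.IH by fastforce
    qed
  qed
  then show ?thesis by (auto simp: eventually_sequentially)
qed

lemma J_eq:
  assumes "u C N = R" and "\<alpha> \<noteq> 2"
  shows "J a b \<alpha> u x C N = ereal (real N * cycle_mean b \<alpha> h)"
proof (rule J_eq_cycle_mean[where lo = "\<lambda>k. min (b * h) (x k)" and hi = "\<lambda>k. max h (x k)"])
  fix k e assume "k < N" "0 < (e :: real)"
  show "\<forall>\<^sub>F i in sequentially. k \<in> R (Z i) \<longrightarrow> \<bar>Z i k - h\<bar> < e"
    using eventually_Z_le
  proof eventually_elim
    case (elim i)
    show ?case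
    proof
      assume "k \<in> R (Z i)"
      then have "Z i k = h" using elim by (intro antisym) (auto simp: R_iff)
      then show "\<bar>Z i k - h\<bar> < e" using \<open>0 < e\<close> by simp
    qed
  qed
qed (use assms T_diverges h_pos lower_pos Y_lower Z_upper in auto)

end

section \<open>An averaging recurrence\<close>

text \<open>Each new value is a convex combination of the preceding \<open>N\<close> values: the
  weights \<open>b\<close> and \<open>N\<close> times \<open>(1 - b) / N\<close> add up to
  one.\<close>

lemma window_bounds_persist:
  fixes M :: "nat \<Rightarrow> real"
  assumes "0 < N" "0 \<le> b" "b \<le> 1"
    and rec: "\<And>n. M (n + N) = b * M n + (1 - b) / real N * (\<Sum>i<N. M (n + i))"
    and start: "\<And>n. p \<le> n \<Longrightarrow> n < p + N \<Longrightarrow> M n \<in> {B..A}"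
  shows "p \<le> n \<Longrightarrow> M n \<in> {B..A}"
proof (induction n rule: less_induct)
  case (less n)
  show ?case
  proof (cases "n < p + N")
    case False
    define q where "q = n - N"
    have n: "n = q + N" "p \<le> q" using False by (auto simp: q_def)
    have win: "M (q + i) \<in> {B..A}" if "i < N" for i
      using less.IH[of "q + i"] that n by simp
    have "real N * B \<le> (\<Sum>i<N. M (q + i))" "(\<Sum>i<N. M (q + i)) \<le> real N * A"
      using win sum_bounded_below[of "{..<N}" B "\<lambda>i. M (q + i)"]
        sum_bounded_above[of "{..<N}" "\<lambda>i. M (q + i)" A] by auto
    moreover have "0 \<le> (1 - b) / real N" using \<open>b \<le> 1\<close> by simp
    ultimately have "(1 - b) / real N * (real N * B) \<le> (1 - b) / real N * (\<Sum>i<N. M (q + i))"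
      and "(1 - b) / real N * (\<Sum>i<N. M (q + i)) \<le> (1 - b) / real N * (real N * A)"
      by (blast intro: mult_left_mono)+
    moreover have "b * B \<le> b * M q" "b * M q \<le> b * A"
      using win[of 0] assms by (auto intro!: mult_left_mono)
    moreover have "(1 - b) / real N * (real N * c) = c - b * c" for c
      using \<open>0 < N\<close> by (simp add: divide_simps) (simp add: algebra_simps)
    ultimately show ?thesis
      unfolding n(1) rec by simp
  qed (use start less.prems in auto)
qed

text \<open>Each window of length \<open>N\<close> contains a value common to all averages that form
  the next window, so the oscillation contracts by the fixed factor \<open>1 - (1 - b) / N\<close>.\<close>

lemma averaging_recurrence_convergent:
  fixes M :: "nat \<Rightarrow> real"
  assumes "0 < N" "0 \<le> b" "b < 1"
    and rec: "\<And>n. M (n + N) = b * M n + (1 - b) / real N * (\<Sum>i<N. M (n + i))"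
  shows "convergent M"
proof -
  \<comment> \<open>The weight that every entry of a window is guaranteed to have in the next
    value.\<close>
  define w where "w = (1 - b) / real N"
  have "(1 - b) / real N \<le> (1 - b) / 1"
    using assms by (intro divide_left_mono) auto
  then have w: "0 < w" "w \<le> 1 - b" using assms by (auto simp: w_def)
  have wN: "w * real N = 1 - b" using assms by (simp add: w_def)
  \<comment> \<open>Entry \<open>j\<close> is split off with weight \<open>w\<close>; the remaining
    weight \<open>1 - w\<close> falls on values between \<open>B\<close> and
    \<open>A\<close>.\<close>
  have weighted: "M (n + N) \<in> {(1 - w) * B + w * v..(1 - w) * A + w * v}"
    if win: "\<And>i. i < N \<Longrightarrow> M (n + i) \<in> {B..A}" and j: "j < N" "M (n + j) = v" for n j v A B
  proof -
    have split: "(\<Sum>i<N. M (n + i)) = v + (\<Sum>i\<in>{..<N} - {j}. M (n + i))"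
      using j by (simp add: sum.remove)
    have card: "card ({..<N} - {j}) = N - 1" using j by simp
    have "real (N - 1) * B \<le> (\<Sum>i\<in>{..<N} - {j}. M (n + i))"
      "(\<Sum>i\<in>{..<N} - {j}. M (n + i)) \<le> real (N - 1) * A"
      using win sum_bounded_below[of "{..<N} - {j}" B "\<lambda>i. M (n + i)"]
        sum_bounded_above[of "{..<N} - {j}" "\<lambda>i. M (n + i)" A] by (auto simp: card)
    then have "w * ((real N - 1) * B) \<le> w * (\<Sum>i\<in>{..<N} - {j}. M (n + i))"
      "w * (\<Sum>i\<in>{..<N} - {j}. M (n + i)) \<le> w * ((real N - 1) * A)"
      using w \<open>0 < N\<close> by (auto intro!: mult_left_mono simp: of_nat_diff)
    then have "(w * real N) * B - w * B \<le> w * (\<Sum>i\<in>{..<N} - {j}. M (n + i))"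
      "w * (\<Sum>i\<in>{..<N} - {j}. M (n + i)) \<le> (w * real N) * A - w * A"
      by (simp_all add: algebra_simps)
    moreover have "b * B \<le> b * M n" "b * M n \<le> b * A"
      using win[of 0] assms by (auto intro!: mult_left_mono)
    ultimately show ?thesis
      unfolding rec w_def[symmetric] split wN by (simp add: algebra_simps)
  qed
  have contract: "\<exists>A B. A - B \<le> (1 - w) ^ m * D \<and> (\<forall>n\<ge>m * N. M n \<in> {B..A})"
    if "\<And>n. n < N \<Longrightarrow> M n \<in> {B0..A0}" "D = A0 - B0" for m A0 B0 D
  proof (induction m)
    case 0
    have "M n \<in> {B0..A0}" for n
      using window_bounds_persist[of N b M 0 B0 A0 n] assms that by simp
    then show ?case using that by (intro exI[of _ A0] exI[of _ B0]) simp
  next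
    case (Suc m)
    then obtain A B where AB: "A - B \<le> (1 - w) ^ m * D" "\<And>n. m * N \<le> n \<Longrightarrow> M n \<in> {B..A}"
      by blast
    \<comment> \<open>The last entry of the first window. It belongs to every window starting at
      \<open>m * N\<close> up to \<open>m * N + (N - 1)\<close>, hence enters all of the next
      \<open>N\<close> values.\<close>
    define v where "v = M (m * N + (N - 1))"
    let ?B = "(1 - w) * B + w * v" and ?A = "(1 - w) * A + w * v"
    have "M n \<in> {?B..?A}" if "Suc m * N \<le> n" "n < Suc m * N + N" for n
    proof -
      define q where "q = n - N"
      have q: "n = q + N" "m * N \<le> q" "q < m * N + N" using that by (auto simp: q_def)
      show ?thesis unfolding q(1)
      proof (rule weighted)
        show "M (q + (m * N + (N - 1) - q)) = v" using q by (simp add: v_def)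
      qed (use AB q \<open>0 < N\<close> in auto)
    qed
    then have "M n \<in> {?B..?A}" if "Suc m * N \<le> n" for n
      using window_bounds_persist[of N b M "Suc m * N" ?B ?A n] assms that by simp
    moreover have "?A - ?B \<le> (1 - w) ^ Suc m * D"
      using mult_left_mono[OF AB(1), of "1 - w"] w assms(2) by (simp add: algebra_simps)
    ultimately show ?case by blast
  qed
  have "Cauchy M"
  proof (rule metric_CauchyI)
    fix e :: real assume "0 < e"
    define A0 where "A0 = Max (M ` {..<N})"
    define B0 where "B0 = Min (M ` {..<N})"
    have "M n \<in> {B0..A0}" if "n < N" for n using that by (simp add: A0_def B0_def)
    note * = contract[OF this refl]
    have "(\<lambda>m. (1 - w) ^ m * (A0 - B0)) \<longlonglongrightarrow> 0 * (A0 - B0)"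
      using w assms by (intro tendsto_intros LIMSEQ_realpow_zero) auto
    then have "\<forall>\<^sub>F m in sequentially. (1 - w) ^ m * (A0 - B0) < e"
      using \<open>0 < e\<close> by (auto dest: order_tendstoD(2))
    then obtain m where m: "(1 - w) ^ m * (A0 - B0) < e"
      by (auto simp: eventually_sequentially)
    obtain A B where AB: "A - B \<le> (1 - w) ^ m * (A0 - B0)" "\<forall>n\<ge>m * N. M n \<in> {B..A}"
      using *[of m] by blast
    have "dist (M i) (M j) < e" if "m * N \<le> i" "m * N \<le> j" for i j
    proof -
      have "M i \<in> {B..A}" "M j \<in> {B..A}" using AB that by auto
      then show ?thesis using AB(1) m by (simp add: dist_real_def abs_less_iff)
    qed
    then show "\<exists>q. \<forall>i\<ge>q. \<forall>j\<ge>q. dist (M i) (M j) < e" by blast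
  qed
  then show ?thesis by (simp add: Cauchy_convergent_iff)
qed

section \<open>The index policy\<close>

text \<open>The index and the tie rule matter only through the selection \<open>p\<close> of a user
  with maximal rate. This is required on positive states only, where index order and rate order can
  be compared.\<close>

locale index_flow =
  fixes a b :: real and R :: "state \<Rightarrow> nat set" and x :: state
    and p :: "state \<Rightarrow> nat" and C :: real and N :: nat
  assumes a_pos: "0 < a" and b_pos: "0 < b" and b_less_1: "b < 1"
    and C_pos: "0 < C" and N_pos: "0 < N" and x_pos: "\<And>k. k < N \<Longrightarrow> 0 < x k"
    and R_eq: "R = (\<lambda>y. if C \<le> (\<Sum>k<N. y k) then {p y} else {})"
    and p_less: "\<And>y. (\<And>k. k < N \<Longrightarrow> 0 < y k) \<Longrightarrow> p y < N"
    and p_max: "\<And>y k. (\<And>k. k < N \<Longrightarrow> 0 < y k) \<Longrightarrow> k < N \<Longrightarrow> y k \<le> y (p y)"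
begin

sublocale impulse_flow a b R x
  by unfold_locales (rule a_pos b_pos b_less_1)+

lemma wait_eq: "wait a R y = max 0 ((C - (\<Sum>k<N. y k)) / (a * real N))"
proof (rule wait_eqI)
  fix r :: real assume "0 \<le> r"
  have "R (drift a r y) \<noteq> {} \<longleftrightarrow> C \<le> (\<Sum>k<N. y k) + real N * (a * r)"
    by (simp add: R_eq drift_def sum.distrib)
  also have "\<dots> \<longleftrightarrow> (C - (\<Sum>k<N. y k)) / (a * real N) \<le> r"
    using a_pos N_pos by (simp add: pos_divide_le_eq algebra_simps)
  finally show "R (drift a r y) \<noteq> {} \<longleftrightarrow> max 0 ((C - (\<Sum>k<N. y k)) / (a * real N)) \<le> r"
    using \<open>0 \<le> r\<close> by simp
qed simp

sublocale forward_flow a b R x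
  by unfold_locales (simp add: wait_eq)

section \<open>Capacity and a priori bounds for the rates\<close>

lemma sum_Z: "(\<Sum>k<N. Z i k) = max C (\<Sum>k<N. Y i k)"
  using a_pos N_pos by (simp add: Z_eq T_Suc wait_eq sum.distrib max_def field_simps)

lemma R_Z: "R (Z i) = {p (Z i)}"
  using sum_Z[of i] by (subst R_eq) simp

lemma Y_Suc': "Y (Suc i) k = (if k = p (Z i) then b * Z i k else Z i k)"
  by (simp add: Y_Suc R_Z)

lemma Y_pos: "k < N \<Longrightarrow> 0 < Y i k"
proof (induction i)
  case (Suc i)
  then have "0 < Z i k" using Y_le_Z[of i k] by simp
  then show ?case using b_pos by (simp add: Y_Suc)
qed (simp add: x_pos)

lemma Z_pos: "k < N \<Longrightarrow> 0 < Z i k"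
  using Y_pos[of k i] Y_le_Z[of i k] by simp

text \<open>The level of the impulse given to state \<open>Z i\<close>, which is the largest rate at
  that moment.\<close>

definition M :: "nat \<Rightarrow> real" where "M i = Z i (p (Z i))"

lemma p_Z_less: "p (Z i) < N"
  using p_less Z_pos by blast

lemma Z_le_M: "k < N \<Longrightarrow> Z i k \<le> M i"
  unfolding M_def using p_max Z_pos by blast

lemma M_lower: "C / real N \<le> M i"
proof -
  have "C \<le> (\<Sum>k<N. Z i k)" by (simp add: sum_Z)
  also have "\<dots> \<le> real N * M i"
    using sum_bounded_above[of "{..<N}" "Z i" "M i"] Z_le_M by simp
  finally show ?thesis using N_pos by (simp add: field_simps)
qed

lemma M_pos: "0 < M i"
proof -
  have "0 < C / real N" using C_pos N_pos by simp
  with M_lower[of i] show ?thesis by (rule less_le_trans[rotated])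
qed

lemma sum_Y_Suc: "(\<Sum>k<N. Y (Suc i) k) = (\<Sum>k<N. Z i k) - (1 - b) * M i"
proof -
  have "(\<Sum>k<N. Z i k - Y (Suc i) k) = (\<Sum>k<N. if k = p (Z i) then (1 - b) * M i else 0)"
    by (intro sum.cong) (auto simp: Y_Suc' M_def algebra_simps)
  also have "\<dots> = (1 - b) * M i" using p_Z_less by simp
  finally show ?thesis by (simp add: sum_subtractf)
qed

lemma Y_lower: "k < N \<Longrightarrow> min (b * (C / real N)) (x k) \<le> Y i k"
proof (induction i)
  case (Suc i)
  then have "min (b * (C / real N)) (x k) \<le> Z i k" using Y_le_Z[of i k] by simp
  moreover have "b * (C / real N) \<le> b * M i"
    using M_lower[of i] b_pos by (intro mult_left_mono) auto
  ultimately show ?case by (auto simp: Y_Suc' M_def)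
qed simp

lemma sum_Z_upper: "(\<Sum>k<N. Z i k) \<le> max C (\<Sum>k<N. x k)"
proof (induction i)
  case (Suc i)
  have "0 \<le> (1 - b) * M i" using M_pos[of i] b_less_1 by simp
  then show ?case using Suc unfolding sum_Z[of "Suc i"] sum_Y_Suc by linarith
qed (simp add: sum_Z)

lemma Z_upper: "k < N \<Longrightarrow> Z i k \<le> max C (\<Sum>k<N. x k)"
  using member_le_sum[of k "{..<N}" "Z i"] Z_pos[of _ i] sum_Z_upper[of i]
  by (fastforce simp: less_imp_le)

lemma T_diverges: "filterlim T at_top sequentially"
proof (rule T_at_top[of "{..<N}" "C / real N"])
  show "\<exists>k\<in>{..<N}. k \<in> R (Z i) \<and> C / real N \<le> Z i k" for i
    using p_Z_less[of i] M_lower[of i] by (auto simp: R_Z M_def)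
qed (use Y_pos C_pos N_pos in auto)

text \<open>After a positive wait the sum starts below \<open>C\<close> and drift stops exactly at
  \<open>C\<close>. Impulses only decrease the sum, so every later drift also ends at
  \<open>C\<close>.\<close>

lemma eventually_sum_Z: "\<forall>\<^sub>F i in sequentially. (\<Sum>k<N. Z i k) = C"
proof -
  obtain i where i: "0 < wait a R (Y i)" using positive_wait[OF T_diverges] .
  have "(\<Sum>k<N. Z j k) = C" if "i \<le> j" for j
    using that
  proof (induction rule: dec_induct)
    case base
    have "0 < (C - (\<Sum>k<N. Y i k)) / (a * real N)"
      using i by (simp add: wait_eq less_max_iff_disj)
    then have "(\<Sum>k<N. Y i k) < C"
      using a_pos N_pos by (simp add: zero_less_divide_iff not_less[symmetric] mult_less_0_iff)
    then show ?case by (simp add: sum_Z)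
  next
    case (step j)
    have "0 \<le> (1 - b) * M j" using M_pos[of j] b_less_1 by simp
    then show ?case using step.IH by (simp add: sum_Z[of "Suc j"] sum_Y_Suc)
  qed
  then show ?thesis by (auto simp: eventually_sequentially)
qed

text \<open>Balance of \<open>k\<close> means that a user served ahead of it cannot land above it.
  The notion is stated per user because each user acquires it at its first service and then keeps
  it.\<close>

definition balanced :: "nat \<Rightarrow> nat \<Rightarrow> bool" where
  "balanced i k \<longleftrightarrow> (\<forall>j<N. b * Y i j \<le> Y i k)"

lemma balanced_Z:
  assumes "balanced i k" "j < N"
  shows "b * Z i j \<le> Z i k"
proof -
  have "0 \<le> (1 - b) * (a * (T (Suc i) - T i))"
    using a_pos b_less_1 wait_nonneg[of i] by (simp add: T_Suc)
  moreover have "b * Y i j \<le> Y i k" using assms by (simp add: balanced_def)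
  ultimately show ?thesis by (simp add: Z_eq algebra_simps)
qed

lemma Y_Suc_le: "k < N \<Longrightarrow> Y (Suc i) k \<le> Z i k"
  using Z_pos[of k i] b_less_1 by (simp add: Y_Suc)

text \<open>The served user lands at \<open>b\<close> times the maximal rate, and no rate exceeds
  that maximum after the impulse.\<close>

lemma balanced_served: "balanced (Suc i) (p (Z i))"
  unfolding balanced_def
proof (intro allI impI)
  fix j assume "j < N"
  then have "Y (Suc i) j \<le> M i" using Y_Suc_le Z_le_M by (meson order_trans)
  then show "b * Y (Suc i) j \<le> Y (Suc i) (p (Z i))"
    using b_pos by (simp add: Y_Suc'[of i "p (Z i)"] M_def)
qed

lemma balanced_Suc:
  assumes "balanced i k"
  shows "balanced (Suc i) k"
proof (cases "k = p (Z i)")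
  case False
  show ?thesis unfolding balanced_def
  proof (intro allI impI)
    fix j assume "j < N"
    then have "b * Y (Suc i) j \<le> b * Z i j" using Y_Suc_le b_pos by simp
    also have "\<dots> \<le> Z i k" using balanced_Z[OF assms \<open>j < N\<close>] .
    finally show "b * Y (Suc i) j \<le> Y (Suc i) k" using False by (simp add: Y_Suc')
  qed
qed (simp add: balanced_served)

text \<open>A user that is never served would grow without bound, whereas the capacity keeps all
  rates bounded.\<close>

lemma eventually_served:
  assumes "k < N"
  shows "\<exists>i. p (Z i) = k"
proof (rule ccontr)
  assume "\<nexists>i. p (Z i) = k"
  then have "x k + a * T n \<le> Z n k" for n
    using levels_telescope[of n k] Y_le_Z[of n k] unfolding Y_Suc' by (simp add: eq_commute[of k])
  then have "a * T n \<le> max C (\<Sum>k<N. x k)" for n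
    using Z_upper[OF assms, of n] x_pos[OF assms] by (meson add_pos_pos le_add_same_cancel2 less_imp_le order_trans)
  then have "T n \<le> max C (\<Sum>k<N. x k) / a" for n
    using a_pos by (simp add: pos_le_divide_eq mult.commute)
  moreover have "\<forall>\<^sub>F n in sequentially. max C (\<Sum>k<N. x k) / a + 1 \<le> T n"
    using T_diverges by (simp add: filterlim_at_top)
  ultimately show False
    by (metis (no_types, lifting) eventually_sequentially le_refl linorder_not_less less_add_one order_trans)
qed

lemma eventually_balanced: "\<forall>\<^sub>F i in sequentially. \<forall>k<N. balanced i k"
proof -
  have "\<forall>\<^sub>F i in sequentially. balanced i k" if k: "k < N" for k
  proof -
    obtain i where "p (Z i) = k" using eventually_served[OF k] by blast
    then have "balanced (Suc i) k" using balanced_served[of i] by simp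
    have "balanced j k" if "Suc i \<le> j" for j
      using that
      by (induction rule: dec_induct) (simp_all add: \<open>balanced (Suc i) k\<close> balanced_Suc)
    then show ?thesis by (auto simp: eventually_sequentially)
  qed
  then show ?thesis
    using eventually_ball_finite[of "{..<N}" "\<lambda>i k. balanced i k" sequentially]
    by (simp add: Ball_def)
qed

text \<open>The sum must regain the loss \<open>(1 - b) * M i\<close>, and the \<open>N\<close>
  users share this growth equally.\<close>

lemma steady_wait:
  assumes "(\<Sum>k<N. Z i k) = C"
  shows "a * (T (Suc (Suc i)) - T (Suc i)) = (1 - b) / real N * M i"
proof -
  have "0 \<le> (1 - b) * M i" using M_pos[of i] b_less_1 by simp
  then show ?thesis
    using a_pos N_pos by (simp add: T_Suc[of "Suc i"] wait_eq sum_Y_Suc assms max_def field_simps)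
qed

text \<open>Measured relative to the common growth, every user stays put between its impulses, and in
  the balanced regime the served user moves from the front to the back of a nonincreasing queue
  \<open>w\<close>. Comparing multisets of rates makes ties irrelevant.\<close>

lemma queue:
  assumes sum_C: "\<And>i. q \<le> i \<Longrightarrow> (\<Sum>k<N. Z i k) = C"
    and bal: "\<And>i k. q \<le> i \<Longrightarrow> k < N \<Longrightarrow> balanced i k"
  defines "\<tau> \<equiv> \<lambda>n. a * T (Suc (q + n))"
  obtains w where "\<And>n. M (q + n) = w n + \<tau> n"
    and "\<And>n. w (n + N) = b * M (q + n) - \<tau> n"
    and "\<And>n. C = (\<Sum>j<N. w (n + j) + \<tau> n)"
proof -
  define L where "L = rev (sorted_list_of_multiset (image_mset (Z q) (mset_set {..<N})))"
  \<comment> \<open>Rates with the common growth removed: first the sorted initial queue, then, at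
    place \<open>n + N\<close>, the user served at step \<open>n\<close>, just after its impulse.
    Since \<open>Z i\<close> is taken at time \<open>T (Suc i)\<close>, so is the growth
    \<tau>.\<close>
  define w where "w n = (if n < N then L ! n - \<tau> 0 else b * M (q + (n - N)) - \<tau> (n - N))" for n
  \<comment> \<open>The entries of \<open>w\<close> from \<open>n\<close> to
    \<open>n + N - 1\<close> are the queue at step \<open>n\<close>, largest rate first.\<close>
  define inv where "inv n \<longleftrightarrow>
    image_mset (Z (q + n)) (mset_set {..<N}) = mset (map (\<lambda>j. w (n + j) + \<tau> n) [0..<N]) \<and>
    (\<forall>i j. i \<le> j \<longrightarrow> j < N \<longrightarrow> w (n + j) \<le> w (n + i))" for n
  have front: "M (q + n) = w n + \<tau> n" if "inv n" for n
  proof -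
    have sets: "Z (q + n) ` {..<N} = (\<lambda>j. w (n + j) + \<tau> n) ` {..<N}"
      using arg_cong[OF conjunct1[OF that[unfolded inv_def]], of set_mset]
      by (simp add: lessThan_atLeast0)
    have "w (n + 0) + \<tau> n \<in> Z (q + n) ` {..<N}" unfolding sets using N_pos by blast
    then have "w n + \<tau> n \<le> M (q + n)" using Z_le_M by auto
    moreover have "M (q + n) \<in> (\<lambda>j. w (n + j) + \<tau> n) ` {..<N}"
      unfolding sets[symmetric] M_def using p_Z_less by blast
    then obtain j where j: "j < N" "M (q + n) = w (n + j) + \<tau> n" by auto
    moreover have "w (n + j) \<le> w (n + 0)"
      using that j unfolding inv_def by blast
    ultimately show ?thesis by simp
  qed
  obtain N' where N': "N = Suc N'" using N_pos gr0_implies_Suc by blast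
  have inv: "inv n" for n
  proof (induction n)
    case 0
    have len: "length L = N"
      by (simp add: L_def flip: size_mset)
    have "map (\<lambda>j. w (0 + j) + \<tau> 0) [0..<N] = map ((!) L) [0..<N]"
      by (simp add: w_def)
    also have "\<dots> = L" using map_nth[of L] len by simp
    finally have "mset (map (\<lambda>j. w (0 + j) + \<tau> 0) [0..<N]) = image_mset (Z q) (mset_set {..<N})"
      by (simp add: L_def)
    moreover have "w j \<le> w i" if "i \<le> j" "j < N" for i j
      using that sorted_rev_nth_mono[of L i j] len by (simp add: w_def L_def)
    ultimately show ?case by (simp add: inv_def)
  next
    case (Suc n)
    let ?i = "q + n"
    let ?p = "p (Z ?i)"
    define d where "d = \<tau> (Suc n) - \<tau> n"
    have Z_Suc: "Z (q + Suc n) k = (if k = ?p then b * M ?i else Z ?i k) + d" for k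
      using Z_eq[of "Suc ?i" k] Y_Suc'[of ?i k] by (simp add: M_def d_def \<tau>_def right_diff_distrib)
    have split: "mset_set {..<N} = add_mset ?p (mset_set ({..<N} - {?p}))"
      using p_Z_less by (intro mset_set.remove) auto
    \<comment> \<open>The served user and the head of the queue have the same rate, so they cancel
      from the two multisets even if they are different users in a tie.\<close>
    have "add_mset (M ?i) (image_mset (Z ?i) (mset_set ({..<N} - {?p})))
        = image_mset (Z ?i) (mset_set {..<N})"
      unfolding split by (simp add: M_def)
    also have "\<dots> = mset (map (\<lambda>j. w (n + j) + \<tau> n) [0..<Suc N'])"
      using Suc by (simp add: inv_def N')
    also have "\<dots> = add_mset (M ?i) (mset (map (\<lambda>j. w (n + Suc j) + \<tau> n) [0..<N']))"
      unfolding map_upt_Suc using front[OF Suc] by simp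
    finally have rest: "image_mset (Z ?i) (mset_set ({..<N} - {?p}))
        = mset (map (\<lambda>j. w (n + Suc j) + \<tau> n) [0..<N'])"
      by simp
    have rear: "w (n + N) = b * M ?i - \<tau> n" by (simp add: w_def)
    have "image_mset (Z (q + Suc n)) (mset_set {..<N})
        = add_mset (b * M ?i + d) (image_mset (\<lambda>k. Z ?i k + d) (mset_set ({..<N} - {?p})))"
    proof -
      have "image_mset (Z (q + Suc n)) (mset_set ({..<N} - {?p}))
          = image_mset (\<lambda>k. Z ?i k + d) (mset_set ({..<N} - {?p}))"
        by (intro image_mset_cong) (use Z_Suc in auto)
      moreover have "Z (q + Suc n) ?p = b * M ?i + d" using Z_Suc by simp
      ultimately show ?thesis unfolding split by simp
    qed
    also have "image_mset (\<lambda>k. Z ?i k + d) (mset_set ({..<N} - {?p}))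
        = image_mset (\<lambda>v. v + d) (image_mset (Z ?i) (mset_set ({..<N} - {?p})))"
      by (simp add: multiset.map_comp comp_def)
    also have "\<dots> = mset (map (\<lambda>j. w (Suc n + j) + \<tau> (Suc n)) [0..<N'])"
      unfolding rest by (simp add: d_def comp_def multiset.map_comp flip: mset_map)
    also have "add_mset (b * M ?i + d) \<dots> = mset (map (\<lambda>j. w (Suc n + j) + \<tau> (Suc n)) [0..<N])"
      using rear by (simp add: N' d_def)
    finally have "image_mset (Z (q + Suc n)) (mset_set {..<N})
        = mset (map (\<lambda>j. w (Suc n + j) + \<tau> (Suc n)) [0..<N])" .
    moreover have "w (Suc n + j) \<le> w (Suc n + i)" if ij: "i \<le> j" "j < N" for i j
    proof -
      consider "j < N'" | "j = N'" "i = N'" | "j = N'" "i < N'" using ij N' by linarith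
      then show ?thesis
      proof cases
        case 1
        then have "w (n + Suc j) \<le> w (n + Suc i)"
          using Suc ij N' unfolding inv_def by (meson Suc_le_mono Suc_mono)
        then show ?thesis by simp
      next
        \<comment> \<open>The only new comparison is between the entry that joins at the rear and
          the others; it is exactly what balance provides.\<close>
        case 3
        have "w (n + Suc i) + \<tau> n \<in># image_mset (Z ?i) (mset_set ({..<N} - {?p}))"
          unfolding rest using 3 by auto
        then have "w (n + Suc i) + \<tau> n \<in> Z ?i ` ({..<N} - {?p})" by simp
        then obtain k where "w (n + Suc i) + \<tau> n = Z ?i k" "k \<in> {..<N} - {?p}"
          by (rule imageE)
        then have k: "k < N" "Z ?i k = w (n + Suc i) + \<tau> n" by simp_all
        have "b * M ?i \<le> Z ?i k"
          unfolding M_def using bal[of ?i k] k p_Z_less by (intro balanced_Z) auto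
        then show ?thesis using rear k 3 by (simp add: N')
      qed simp
    qed
    ultimately show ?case by (simp add: inv_def)
  qed
  have "C = (\<Sum>j<N. w (n + j) + \<tau> n)" for n
  proof -
    have "C = sum_mset (image_mset (Z (q + n)) (mset_set {..<N}))"
      using sum_C[of "q + n"] by (simp add: sum_unfold_sum_mset)
    also have "\<dots> = sum_list (map (\<lambda>j. w (n + j) + \<tau> n) [0..<N])"
      using inv[of n] by (simp only: inv_def sum_mset_sum_list)
    finally show ?thesis by (simp only: interv_sum_list_conv_sum_set_nat atLeast0LessThan set_upt)
  qed
  then show thesis using that[of w] front[OF inv] by (simp add: w_def)
qed

text \<open>Once the levels tend to some \<open>l\<close>, the queue at a service consists in the
  limit of \<open>l - (1 - b) * l * j / N\<close> for \<open>j < N\<close>. These sum to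
  \<open>l * (N * (1 + b) + 1 - b) / 2\<close>, which the capacity equates with
  \<open>C\<close>.\<close>

lemma M_limit: "M \<longlonglongrightarrow> 2 * C / (real N * (1 + b) + (1 - b))"
proof -
  obtain q where "\<forall>i\<ge>q. (\<Sum>k<N. Z i k) = C \<and> (\<forall>k<N. balanced i k)"
    using eventually_conj[OF eventually_sum_Z eventually_balanced]
    by (auto simp only: eventually_sequentially)
  then have q: "(\<Sum>k<N. Z i k) = C" "k < N \<Longrightarrow> balanced i k" if "q \<le> i" for i k
    using that by blast+
  define \<tau> where "\<tau> n = a * T (Suc (q + n))" for n
  obtain w where w: "\<And>n. M (q + n) = w n + \<tau> n" "\<And>n. w (n + N) = b * M (q + n) - \<tau> n"
    "\<And>n. C = (\<Sum>j<N. w (n + j) + \<tau> n)"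
    unfolding \<tau>_def using queue[OF q] by blast
  have \<tau>: "\<tau> (n + j) = \<tau> n + (1 - b) / real N * (\<Sum>i<j. M (q + (n + i)))" for n j
  proof (induction j)
    case (Suc j)
    have "\<tau> (Suc (n + j)) - \<tau> (n + j) = (1 - b) / real N * M (q + (n + j))"
      using steady_wait[OF q(1), of "q + (n + j)"] by (simp add: \<tau>_def right_diff_distrib)
    with Suc show ?case by (simp add: algebra_simps)
  qed simp
  \<comment> \<open>Place \<open>n + N\<close> of the queue is read twice: when it is filled by the
    impulse at step \<open>n\<close>, and when it is at the front \<open>N\<close> steps
    later.\<close>
  have "M (q + (n + N)) = b * M (q + n) + (1 - b) / real N * (\<Sum>i<N. M (q + (n + i)))" for n
    using w(1)[of "n + N"] w(2)[of n] \<tau>[of n N] by simp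
  then have "convergent (\<lambda>n. M (q + n))"
    using averaging_recurrence_convergent[of N b "\<lambda>n. M (q + n)"] N_pos b_pos b_less_1 by simp
  then obtain l where l: "(\<lambda>n. M (q + n)) \<longlonglongrightarrow> l" by (auto simp: convergent_def)
  have l': "(\<lambda>n. M (q + (n + i))) \<longlonglongrightarrow> l" for i
    using LIMSEQ_ignore_initial_segment[OF l] .
  \<comment> \<open>Every queue entry is expressed by the level at which it will be served, less the
    growth until then, so that the capacity equation passes to the limit.\<close>
  have "C = (\<Sum>j<N. M (q + (n + j)) - (1 - b) / real N * (\<Sum>i<j. M (q + (n + i))))" for n
  proof -
    have "w (n + j) + \<tau> n = M (q + (n + j)) - (1 - b) / real N * (\<Sum>i<j. M (q + (n + i)))" for j
      using w(1)[of "n + j"] \<tau>[of n j] by linarith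
    then show ?thesis by (simp only: w(3)[of n])
  qed
  then have "(\<lambda>n. C) = (\<lambda>n. \<Sum>j<N. M (q + (n + j)) - (1 - b) / real N * (\<Sum>i<j. M (q + (n + i))))"
    by (rule ext)
  also have "\<dots> \<longlonglongrightarrow> (\<Sum>j<N. l - (1 - b) / real N * (\<Sum>i<j. l))"
    by (intro tendsto_intros l')
  finally have "C = (\<Sum>j<N. l - (1 - b) / real N * (real j * l))"
    by (simp add: LIMSEQ_const_iff)
  also have "\<dots> = real N * l - (1 - b) / real N * l * (\<Sum>j<N. real j)"
    by (simp add: sum_subtractf sum_distrib_left sum_divide_distrib mult_ac)
  also have "(\<Sum>j<N. real j) = real N * (real N - 1) / 2"
    by (induction N) (simp_all add: field_simps)
  also have "(1 - b) / real N * l * (real N * (real N - 1) / 2) = (1 - b) * l * (real N - 1) / 2"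
    using N_pos by simp
  finally have "l * (real N * (1 + b) + (1 - b)) = 2 * C"
    by (simp add: field_simps)
  moreover have "0 < real N * (1 + b) + (1 - b)"
    using b_pos b_less_1 by (intro add_nonneg_pos) auto
  ultimately have "l = 2 * C / (real N * (1 + b) + (1 - b))"
    by (simp add: field_simps)
  then show ?thesis using l LIMSEQ_offset[of M q] by (simp add: add.commute)
qed

lemma J_eq:
  assumes "u C N = R" and "\<alpha> \<noteq> 2"
  shows "J a b \<alpha> u x C N = ereal (real N * cycle_mean b \<alpha> (2 * C / (real N * (1 + b) + (1 - b))))"
proof (rule J_eq_cycle_mean[where lo = "\<lambda>k. min (b * (C / real N)) (x k)"
      and hi = "\<lambda>_. max C (\<Sum>k<N. x k)"])
  fix k e assume "k < N" "0 < (e :: real)"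
  show "\<forall>\<^sub>F i in sequentially. k \<in> R (Z i) \<longrightarrow>
      \<bar>Z i k - 2 * C / (real N * (1 + b) + (1 - b))\<bar> < e"
    using tendstoD[OF M_limit \<open>0 < e\<close>]
    by eventually_elim (auto simp: R_Z M_def dist_real_def)
next
  show "0 < 2 * C / (real N * (1 + b) + (1 - b))"
    using C_pos b_pos b_less_1 by (intro divide_pos_pos add_nonneg_pos) auto
qed (use assms T_diverges b_pos C_pos N_pos x_pos Y_lower Z_upper in auto)

end

text \<open>The numerator \<open>1 - b powr (2 - \<alpha>)\<close> and the factor
  \<open>2 - \<alpha>\<close> have the same sign, on either side of \<open>\<alpha> = 2\<close>. The
  coefficient is therefore positive, and a negative power is strictly decreasing.\<close>

lemma index_fun_less_iff:
  assumes "0 < b" "b < 1" "0 < \<alpha>" "\<alpha> \<noteq> 2" "0 < v" "0 < w"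
  shows "index_fun b \<alpha> v < index_fun b \<alpha> w \<longleftrightarrow> w < v"
proof -
  have "0 < (1 - b powr (2 - \<alpha>)) / (2 - \<alpha>)"
  proof (cases "\<alpha> < 2")
    case True
    then have "b powr (2 - \<alpha>) < b powr 0" using assms by (intro powr_less_mono') auto
    then show ?thesis using True assms by simp
  next
    case False
    then have "b powr 0 < b powr (2 - \<alpha>)" using False assms by (intro powr_less_mono') auto
    then show ?thesis using False assms by (intro divide_neg_neg) auto
  qed
  moreover have "b\<^sup>2 < 1" using assms by (simp add: power_less_one_iff)
  ultimately have "0 < 2 / (1 - b\<^sup>2) * ((1 - b powr (2 - \<alpha>)) / (2 - \<alpha>))" by (intro mult_pos_pos) simp_all
  then have pos: "0 < 2 * (1 - b powr (2 - \<alpha>)) / ((1 - b\<^sup>2) * (2 - \<alpha>))"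
    unfolding times_divide_times_eq .
  have "v powr - \<alpha> < w powr - \<alpha> \<longleftrightarrow> w < v"
    using assms powr_less_mono2_neg[of "- \<alpha>" w v] powr_less_mono2_neg[of "- \<alpha>" v w]
    by (cases v w rule: linorder_cases) auto
  then show ?thesis
    unfolding index_fun_def using mult_less_cancel_left_pos[OF pos] by simp
qed

section \<open>Asymptotic optimality\<close>

text \<open>With capacity \<open>c * N\<close> the threshold no longer depends on \<open>N\<close>,
  so the value per user is constant.\<close>

lemma J_threshold_policy:
  assumes "0 < c" "0 < a" "0 < b" "b < 1" "\<alpha> \<noteq> 2" "0 < N" "\<And>k. k < N \<Longrightarrow> 0 < x k"
  shows "J a b \<alpha> (threshold_policy b) x (c * real N) N
    = ereal (real N * cycle_mean b \<alpha> (2 * c / (1 + b)))"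
proof -
  have "1 - b\<^sup>2 = (1 - b) * (1 + b)" by (simp add: power2_eq_square algebra_simps)
  then have h: "threshold b (c * real N) N = 2 * c / (1 + b)"
    using assms unfolding threshold_def by (simp only: nonzero_mult_divide_mult_cancel_left mult_ac) (simp add: divide_simps)
  interpret threshold_flow a b "threshold_policy b (c * real N) N" x "2 * c / (1 + b)" N
    using assms by unfold_locales (auto simp: threshold_policy_def fun_eq_iff h)
  show ?thesis using assms by (intro J_eq) auto
qed

lemma J_index_policy:
  assumes "0 < c" "0 < a" "0 < b" "b < 1" "0 < \<alpha>" "\<alpha> \<noteq> 2" "0 < N" "\<And>k. k < N \<Longrightarrow> 0 < x k"
    and tie: "is_tie_rule tie"
  shows "J a b \<alpha> (index_policy b \<alpha> tie) x (c * real N) N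
    = ereal (real N * cycle_mean b \<alpha> (2 * (c * real N) / (real N * (1 + b) + (1 - b))))"
proof -
  define S where "S y = {k. is_arg_min (\<lambda>j. index_fun b \<alpha> (y j)) (\<lambda>j. j < N) k}" for y :: state
  have "tie N y (S y) < N \<and> (\<forall>k<N. y k \<le> y (tie N y (S y)))"
    if pos: "\<And>k. k < N \<Longrightarrow> 0 < y k" for y
  proof -
    \<comment> \<open>Minimal index is translated into maximal rate, for ties as well, so any tie
      rule yields an admissible selection.\<close>
    have S: "S y = {k. k < N \<and> (\<forall>j<N. y j \<le> y k)}"
      using index_fun_less_iff[OF assms(3-6) pos pos]
      by (auto simp: S_def is_arg_min_def not_less[symmetric])
    have "Max (y ` {..<N}) \<in> y ` {..<N}" using \<open>0 < N\<close> by (intro Max_in) auto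
    then obtain k where "k < N" "y k = Max (y ` {..<N})" by auto
    then have "k \<in> S y" by (simp add: S)
    moreover have "finite (S y)" by (rule finite_subset[of _ "{..<N}"]) (auto simp: S)
    ultimately have "tie N y (S y) \<in> S y" using tie by (auto simp: is_tie_rule_def)
    then show ?thesis by (simp add: S)
  qed
  then interpret index_flow a b "index_policy b \<alpha> tie (c * real N) N" x
    "\<lambda>y. tie N y (S y)" "c * real N" N
    using assms by unfold_locales (auto simp: index_policy_def fun_eq_iff S_def)
  show ?thesis using assms by (intro J_eq) auto
qed

theorem theorem3:
  fixes a b c \<alpha> :: real
    and tie :: tie_rule
    and x :: "nat \<Rightarrow> state"
  assumes "c > 0" and "a > 0" and "0 < b" and "b < 1"
    and "\<alpha> > 0" and "\<alpha> \<noteq> 1" and "\<alpha> \<noteq> 2"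
    and "is_tie_rule tie"
    and "\<And>N k. N \<ge> 1 \<Longrightarrow> k < N \<Longrightarrow> x N k > 0"
  shows "\<exists>L::real.
    ((\<lambda>N. ereal (1 / real N) * J a b \<alpha> (index_policy b \<alpha> tie) (x N) (c * real N) N)
       \<longlonglongrightarrow> ereal L) \<and>
    ((\<lambda>N. ereal (1 / real N) * J a b \<alpha> (threshold_policy b) (x N) (c * real N) N)
       \<longlonglongrightarrow> ereal L)"
proof (intro exI conjI)
  let ?h = "2 * c / (1 + b)"
  \<comment> \<open>The exact value per user under the threshold policy; the index policy reaches it
    by continuity of \<open>cycle_mean\<close> as its service level tends to the threshold.\<close>
  let ?L = "cycle_mean b \<alpha> ?h"
  have "(\<lambda>N. 2 * (c * real N) / (real N * (1 + b) + (1 - b))) \<longlonglongrightarrow> ?h"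
  proof -
    have "(\<lambda>N. 2 * c / ((1 + b) + (1 - b) / real N)) \<longlonglongrightarrow> 2 * c / ((1 + b) + 0)"
      using \<open>0 < b\<close> by (intro tendsto_intros lim_const_over_n) auto
    moreover have "\<forall>\<^sub>F N in sequentially. 2 * c / ((1 + b) + (1 - b) / real N)
        = 2 * (c * real N) / (real N * (1 + b) + (1 - b))"
      using eventually_gt_at_top[of 0]
    proof eventually_elim
      case (elim N)
      then have "real N * (1 + b) + (1 - b) = real N * ((1 + b) + (1 - b) / real N)"
        by (simp add: field_simps)
      then show ?case using elim by simp
    qed
    ultimately show ?thesis by (simp add: tendsto_cong)
  qed
  then have "(\<lambda>N. cycle_mean b \<alpha> (2 * (c * real N) / (real N * (1 + b) + (1 - b)))) \<longlonglongrightarrow> ?L"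
    using assms by (intro isCont_tendsto_compose[OF isCont_cycle_mean]) auto
  moreover have "\<forall>\<^sub>F N in sequentially.
      ereal (cycle_mean b \<alpha> (2 * (c * real N) / (real N * (1 + b) + (1 - b))))
      = ereal (1 / real N) * J a b \<alpha> (index_policy b \<alpha> tie) (x N) (c * real N) N"
    using eventually_gt_at_top[of 0]
    by eventually_elim (use assms in \<open>simp add: J_index_policy\<close>)
  ultimately show "(\<lambda>N. ereal (1 / real N) * J a b \<alpha> (index_policy b \<alpha> tie) (x N) (c * real N) N)
      \<longlonglongrightarrow> ereal ?L"
    by (blast intro: Lim_transform_eventually tendsto_ereal)
  have "\<forall>\<^sub>F N in sequentially. ereal ?L
      = ereal (1 / real N) * J a b \<alpha> (threshold_policy b) (x N) (c * real N) N"
    using eventually_gt_at_top[of 0]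
    by eventually_elim (use assms in \<open>simp add: J_threshold_policy\<close>)
  then show "(\<lambda>N. ereal (1 / real N) * J a b \<alpha> (threshold_policy b) (x N) (c * real N) N)
      \<longlonglongrightarrow> ereal ?L"
    by (blast intro: Lim_transform_eventually tendsto_const)
qed

end
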